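(* Let $m$ and $n$ be positive integers with $n\ge 3$, let $k\in\mathbb{Z}_n^\times$ have multiplicative order $\alpha$ with $\alpha \mid m$, and let $G_{m,n,k}$ be the split metacyclic group given by the presentation $$G_{m,n,k} = \langle x, y : x^m = 1 = y^{n},\ x^{-1} yx = y^k \rangle .$$ If $\alpha$ is even and $k^{\alpha/2} \equiv -1 \pmod{n}$, then $$\mathrm{diam}(G_{m,n,k}) \leq \begin{cases} [m/2] + \mathrm{wt}(n, k; \alpha), & \text{if } \alpha \neq m, \\ [m/2] + \mathrm{wt}(n, k; \alpha) + \deg(n,k;\alpha), & \text{if } \alpha = m. \end{cases}$$
   Context: $[\cdot]$ denotes the integer part (floor). $\mathbb{Z}_n$ is the ring of integers modulo $n$ and $\mathbb{Z}_n^\times$ its group of units. $\mathrm{diam}(G_{m,n,k})$ is the graph diameter of the Cayley graph of $G_{m,n,k}$ with respect to the generating set $\{x,x^{-1},y,y^{-1}\}$. Let $n\ge 3$ and let $k\in\mathbb{Z}_n^\times$ have multiplicative order $\alpha\ge 2$. For a sequence of integers $\underline{i}=(i_1,\dots,i_r)$ ($r\ge 1$) with $\alpha-1\ge i_1>i_2>\dots>i_r\ge 0$ and a sequence of integers $\underline{\lambda}=(\lambda_1,\dots,\lambda_r)$ with all $\lambda_j\ge 0$, put $$\Omega(\underline{i},\underline{\lambda})=\{\,b_1k^{i_1}+\dots+b_rk^{i_r} \pmod n : b_j\in\mathbb{Z},\ |b_j|\le\lambda_j,\ 1\le j\le r\,\}\subseteq\mathbb{Z}_n .$$ The integer $r$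 is the length of $\underline{i}$ and $\deg(\underline{i}):=i_1$ is its degree. The sequence $\underline{i}$ is reduced if $i_r=0$. Define $$\mathrm{wt}(n,k;\underline{i})=\min\{\lambda_1+\dots+\lambda_r : \Omega(\underline{i},\underline{\lambda})=\mathbb{Z}_n\},$$ and, for $1\le r\le\alpha$, let $\mathrm{wt}(n,k;r)$ be the minimum of $\mathrm{wt}(n,k;\underline{i})$ over all such sequences $\underline{i}$ of length $r$. In particular $\mathrm{wt}(n,k;\alpha)=\mathrm{wt}(n,k;\Delta)$ with $\Delta=(\alpha-1,\alpha-2,\dots,1,0)$. Let $S(\alpha)$ be the set of reduced sequences $\underline{j}$ (of any length at most $\alpha$) with $\mathrm{wt}(n,k;\underline{j})=\mathrm{wt}(n,k;\alpha)$. A minimal prime sequence realizing $\mathrm{wt}(n,k;\alpha)$ is an element of $S(\alpha)$ whose length is the smallest among all elements of $S(\alpha)$. $\deg(n,k;\alpha)$ denotes the smallest possible degree of a minimal prime sequence realizing $\mathrm{wt}(n,k;\alpha)$. *)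

theory Defs
  imports
    "HOL-Number_Theory.Number_Theory"
    "Graph_Theory.Pair_Digraph"
    "Graph_Theory.Shortest_Path"
begin

section \<open>Groups given by generators and relations\<close>

text \<open>
  A word is a list of letters; the letter \<open>(a, False)\<close> stands for the generator \<open>a\<close> and
  \<open>(a, True)\<close> for its formal inverse. All elements of the type \<open>'a\<close> are generators.
  A relation \<open>u = v\<close> is the pair \<open>(u, v)\<close>.
\<close>

type_synonym 'a word = "('a \<times> bool) list"

definition word_inv :: "'a word \<Rightarrow> 'a word" where
  "word_inv w = map (\<lambda>(a, s). (a, \<not> s)) (rev w)"

inductive pres_eq :: "('a word \<times> 'a word) set \<Rightarrow> 'a word \<Rightarrow> 'a word \<Rightarrow> bool"
  for R :: "('a word \<times> 'a word) set"
where
  cancel: "pres_eq R [(a, s), (a, \<not> s)] []"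
| rel: "(u, v) \<in> R \<Longrightarrow> pres_eq R u v"
| append: "pres_eq R u u' \<Longrightarrow> pres_eq R v v' \<Longrightarrow> pres_eq R (u @ v) (u' @ v')"
| refl: "pres_eq R u u"
| sym: "pres_eq R u v \<Longrightarrow> pres_eq R v u"
| trans: "pres_eq R u v \<Longrightarrow> pres_eq R v w \<Longrightarrow> pres_eq R u w"

definition word_class :: "('a word \<times> 'a word) set \<Rightarrow> 'a word \<Rightarrow> 'a word set" where
  "word_class R u = {v. pres_eq R u v}"

definition presented_group :: "('a word \<times> 'a word) set \<Rightarrow> 'a word set monoid" where
  "presented_group R =
     \<lparr>carrier = range (word_class R),
      monoid.mult = (\<lambda>A B. \<Union>u\<in>A. \<Union>v\<in>B. word_class R (u @ v)),
      one = word_class R []\<rparr>"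

lemma word_class_eq_iff: "word_class R u = word_class R v \<longleftrightarrow> pres_eq R u v"
proof
  assume "word_class R u = word_class R v"
  moreover have "v \<in> word_class R v" by (simp add: word_class_def pres_eq.refl)
  ultimately have "v \<in> word_class R u" by simp
  then show "pres_eq R u v" by (simp add: word_class_def)
next
  assume uv: "pres_eq R u v"
  have "pres_eq R u w \<longleftrightarrow> pres_eq R v w" for w
    using pres_eq.trans[OF uv, of w] pres_eq.trans[OF pres_eq.sym[OF uv], of w] by blast
  then show "word_class R u = word_class R v"
    by (simp add: word_class_def)
qed

lemma presented_group_mult:
  "word_class R u \<otimes>\<^bsub>presented_group R\<^esub> word_class R v = word_class R (u @ v)"
proof -
  have "word_class R (u' @ v') = word_class R (u @ v)"
    if "u' \<in> word_class R u" "v' \<in> word_class R v" for u' v'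
  proof -
    have "pres_eq R u u'" "pres_eq R v v'"
      using that by (simp_all add: word_class_def)
    then show ?thesis
      unfolding word_class_eq_iff by (intro pres_eq.sym[OF pres_eq.append])
  qed
  then have "(\<Union>u'\<in>word_class R u. \<Union>v'\<in>word_class R v. word_class R (u' @ v')) =
      (\<Union>u'\<in>word_class R u. \<Union>v'\<in>word_class R v. word_class R (u @ v))"
    by (intro SUP_cong HOL.refl)
  moreover have "word_class R u \<noteq> {}" "word_class R v \<noteq> {}"
    by (auto simp: word_class_def intro: pres_eq.refl)
  ultimately show ?thesis
    by (simp add: presented_group_def)
qed

lemma pres_eq_word_inv: "pres_eq R (word_inv w @ w) []"
proof (induction w)
  case Nil
  then show ?case by (simp add: word_inv_def pres_eq.refl)
next
  case (Cons l w)
  obtain a s where l: "l = (a, s)" by (cases l)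
  have "pres_eq R [(a, \<not> s), (a, s)] []"
    using pres_eq.cancel[of R a "\<not> s"] by simp
  then have "pres_eq R (word_inv w @ [(a, \<not> s), (a, s)] @ w) (word_inv w @ [] @ w)"
    by (intro pres_eq.append pres_eq.refl)
  then have "pres_eq R (word_inv w @ [(a, \<not> s), (a, s)] @ w) []"
    using pres_eq.trans[OF _ Cons.IH] by simp
  then show ?case by (simp add: word_inv_def l)
qed

lemma group_presented_group: "group (presented_group R)"
proof (rule groupI)
  fix A assume "A \<in> carrier (presented_group R)"
  then obtain w where w: "A = word_class R w" by (auto simp: presented_group_def)
  have "word_class R (word_inv w) \<otimes>\<^bsub>presented_group R\<^esub> A = \<one>\<^bsub>presented_group R\<^esub>"
    unfolding w presented_group_mult
    by (simp add: presented_group_def word_class_eq_iff pres_eq_word_inv)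
  then show "\<exists>B\<in>carrier (presented_group R). B \<otimes>\<^bsub>presented_group R\<^esub> A = \<one>\<^bsub>presented_group R\<^esub>"
    by (auto simp: presented_group_def)
next
  fix A B C
  assume "A \<in> carrier (presented_group R)" "B \<in> carrier (presented_group R)"
    "C \<in> carrier (presented_group R)"
  then obtain u v w where "A = word_class R u" "B = word_class R v" "C = word_class R w"
    by (auto simp: presented_group_def)
  then show "A \<otimes>\<^bsub>presented_group R\<^esub> B \<otimes>\<^bsub>presented_group R\<^esub> C =
      A \<otimes>\<^bsub>presented_group R\<^esub> (B \<otimes>\<^bsub>presented_group R\<^esub> C)"
    by (simp add: presented_group_mult)
next
  fix A B
  assume "A \<in> carrier (presented_group R)" "B \<in> carrier (presented_group R)"
  then obtain u v where "A = word_class R u" "B = word_class R v"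
    by (auto simp: presented_group_def)
  then have "A \<otimes>\<^bsub>presented_group R\<^esub> B = word_class R (u @ v)"
    by (simp add: presented_group_mult)
  then show "A \<otimes>\<^bsub>presented_group R\<^esub> B \<in> carrier (presented_group R)"
    by (simp add: presented_group_def)
next
  fix A assume "A \<in> carrier (presented_group R)"
  then obtain u where u: "A = word_class R u" by (auto simp: presented_group_def)
  have "\<one>\<^bsub>presented_group R\<^esub> = word_class R []" by (simp add: presented_group_def)
  then show "\<one>\<^bsub>presented_group R\<^esub> \<otimes>\<^bsub>presented_group R\<^esub> A = A"
    by (simp add: u presented_group_mult)
qed (simp add: presented_group_def)

section \<open>Split metacyclic groups\<close>

datatype xy = X | Y

definition metacyclic_rels :: "nat \<Rightarrow> nat \<Rightarrow> nat \<Rightarrow> (xy word \<times> xy word) set" where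
  "metacyclic_rels m n k =
     {(replicate m (X, False), []),
      (replicate n (Y, False), []),
      ([(X, True), (Y, False), (X, False)], replicate k (Y, False))}"

definition metacyclic_group :: "nat \<Rightarrow> nat \<Rightarrow> nat \<Rightarrow> xy word set monoid" where
  "metacyclic_group m n k = presented_group (metacyclic_rels m n k)"

definition metacyclic_gen :: "nat \<Rightarrow> nat \<Rightarrow> nat \<Rightarrow> xy \<Rightarrow> xy word set" where
  "metacyclic_gen m n k a = word_class (metacyclic_rels m n k) [(a, False)]"

section \<open>Cayley graphs and diameter\<close>

definition cayley_graph :: "('g, 'm) monoid_scheme \<Rightarrow> 'g set \<Rightarrow> 'g pair_pre_digraph" where
  "cayley_graph G S =
     \<lparr>pverts = carrier G, parcs = {(g, g \<otimes>\<^bsub>G\<^esub> s) | g s. g \<in> carrier G \<and> s \<in> S}\<rparr>"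

text \<open>
  The least cost of a walk when all arcs have cost 1 is the usual distance; it is \<open>\<infinity>\<close> between
  unconnected vertices.
\<close>

definition diameter :: "('a, 'b) pre_digraph \<Rightarrow> ereal" where
  "diameter D = (SUP u\<in>verts D. SUP v\<in>verts D. wf_digraph.\<mu> D (\<lambda>_. 1) u v)"

lemma wf_digraph_cayley_graph:
  assumes "group G" "S \<subseteq> carrier G"
  shows "wf_digraph (with_proj (cayley_graph G S))"
proof -
  interpret group G by fact
  show ?thesis
    using assms(2) by unfold_locales (auto simp: cayley_graph_def)
qed

definition metacyclic_diam :: "nat \<Rightarrow> nat \<Rightarrow> nat \<Rightarrow> ereal" where
  "metacyclic_diam m n k =
     (let G = metacyclic_group m n k; x = metacyclic_gen m n k X; y = metacyclic_gen m n k Y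
      in diameter (with_proj (cayley_graph G {x, inv\<^bsub>G\<^esub> x, y, inv\<^bsub>G\<^esub> y})))"

section \<open>Weights and degrees\<close>

text \<open>
  A unit of the integers modulo \<open>n\<close> is given by a representative \<open>k :: nat\<close> coprime to \<open>n\<close>; its
  multiplicative order is \<open>ord n k\<close>. Sequences are lists, so the first entry of a sequence is its
  head. The minima below are written as \<open>Inf\<close> on \<open>nat\<close>; they range over nonempty sets whenever
  \<open>n > 0\<close> and \<open>k\<close> is coprime to \<open>n\<close>, see the lemmas at the end.
\<close>

definition exponent_seq :: "nat \<Rightarrow> nat \<Rightarrow> nat list \<Rightarrow> bool" where
  "exponent_seq n k js \<longleftrightarrow> js \<noteq> [] \<and> sorted_wrt (>) js \<and> (\<forall>j\<in>set js. j < ord n k)"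

definition reduced :: "nat list \<Rightarrow> bool" where
  "reduced js \<longleftrightarrow> last js = 0"

definition deg_seq :: "nat list \<Rightarrow> nat" where
  "deg_seq js = hd js"

definition Omega :: "nat \<Rightarrow> nat \<Rightarrow> nat list \<Rightarrow> nat list \<Rightarrow> int set" where
  "Omega n k js ls =
     {(\<Sum>j<length js. b j * int k ^ (js ! j)) mod int n | b :: nat \<Rightarrow> int.
        \<forall>j<length js. \<bar>b j\<bar> \<le> int (ls ! j)}"

definition wt_seq :: "nat \<Rightarrow> nat \<Rightarrow> nat list \<Rightarrow> nat" where
  "wt_seq n k js =
     Inf {sum_list ls | ls.
       length ls = length js \<and> Omega n k js ls = carrier (residue_ring (int n))}"

definition wt :: "nat \<Rightarrow> nat \<Rightarrow> nat \<Rightarrow> nat" where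
  "wt n k r = Inf {wt_seq n k js | js. exponent_seq n k js \<and> length js = r}"

definition realizing_seqs :: "nat \<Rightarrow> nat \<Rightarrow> nat list set" where
  "realizing_seqs n k =
     {js. exponent_seq n k js \<and> reduced js \<and> wt_seq n k js = wt n k (ord n k)}"

definition minimal_prime_seqs :: "nat \<Rightarrow> nat \<Rightarrow> nat list set" where
  "minimal_prime_seqs n k =
     {js \<in> realizing_seqs n k. \<forall>is\<in>realizing_seqs n k. length js \<le> length is}"

definition deg_wt :: "nat \<Rightarrow> nat \<Rightarrow> nat" where
  "deg_wt n k = Inf (deg_seq ` minimal_prime_seqs n k)"

lemma wt_seq_attained:
  assumes "n > 0" "coprime n k" "exponent_seq n k js"
  shows "\<exists>ls. length ls = length js \<and> Omega n k js ls = carrier (residue_ring (int n))"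
proof -
  let ?ls = "replicate (length js) n"
  have "Omega n k js ?ls = {0..int n - 1}"
  proof
    show "Omega n k js ?ls \<subseteq> {0..int n - 1}"
      using assms(1) by (auto simp: Omega_def)
    show "{0..int n - 1} \<subseteq> Omega n k js ?ls"
    proof
      fix c assume c: "c \<in> {0..int n - 1}"
      let ?u = "int k ^ (js ! 0)"
      have len: "0 < length js" using assms(3) by (simp add: exponent_seq_def)
      have "coprime ?u (int n)"
        using assms(2) by (simp add: coprime_commute)
      then obtain d where d: "[?u * d = 1] (mod int n)"
        using cong_solve_coprime_int by blast
      define b where "b j = (if j = 0 then (c * d) mod int n else 0)" for j :: nat
      have "(\<Sum>j<length js. b j * int k ^ (js ! j)) = b 0 * ?u"
        using len by (subst sum.remove[of _ 0]) (auto simp: b_def intro!: sum.neutral)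
      moreover have "[b 0 * ?u = c] (mod int n)"
      proof -
        have "[b 0 * ?u = c * d * ?u] (mod int n)"
          by (simp add: b_def cong_def mod_mult_left_eq)
        also have "[c * d * ?u = c] (mod int n)"
          using cong_scalar_left[OF d, of c] by (simp add: mult_ac)
        finally show ?thesis .
      qed
      ultimately have "c = (\<Sum>j<length js. b j * int k ^ (js ! j)) mod int n"
        using c by (simp add: cong_def)
      moreover have "\<bar>b j\<bar> \<le> int (?ls ! j)" if "j < length js" for j
        using that assms(1) by (auto simp: b_def intro: less_imp_le)
      ultimately show "c \<in> Omega n k js ?ls"
        unfolding Omega_def by blast
    qed
  qed
  then show ?thesis
    by (intro exI[of _ ?ls]) (simp add: residue_ring_def)
qed

lemma exponent_seq_full:
  assumes "coprime n k" "n > 0"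
  shows "exponent_seq n k (rev [0..<ord n k])"
proof -
  have "ord n k > 0" using assms(1) by (simp add: ord_eq_0)
  then show ?thesis by (simp add: exponent_seq_def sorted_wrt_rev)
qed

lemma exponent_seq_full_unique:
  assumes "exponent_seq n k js" "length js = ord n k"
  shows "js = rev [0..<ord n k]"
proof -
  have *: "sorted_wrt (<) (rev js)"
    using assms(1) by (simp add: exponent_seq_def sorted_wrt_rev)
  then have "distinct js"
    by (simp add: strict_sorted_iff)
  then have "card (set js) = ord n k"
    using assms(2) by (simp add: distinct_card)
  moreover have "set js \<subseteq> {..<ord n k}"
    using assms(1) by (auto simp: exponent_seq_def)
  ultimately have "set js = {..<ord n k}"
    by (simp add: card_subset_eq)
  then have "rev js = [0..<ord n k]"
    using * strict_sorted_equal[of "rev js" "[0..<ord n k]"]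
    by (simp add: atLeast0LessThan)
  then show ?thesis by (simp add: rev_swap)
qed

lemma wt_full:
  assumes "coprime n k" "n > 0"
  shows "wt n k (ord n k) = wt_seq n k (rev [0..<ord n k])"
proof -
  let ?js = "rev [0..<ord n k]"
  have "exponent_seq n k js \<and> length js = ord n k \<longleftrightarrow> js = ?js" for js
    using exponent_seq_full[OF assms] exponent_seq_full_unique[of n k js]
    by auto
  then show ?thesis by (simp add: wt_def)
qed

lemma minimal_prime_seqs_nonempty:
  assumes "coprime n k" "n > 0"
  shows "minimal_prime_seqs n k \<noteq> {}"
proof -
  have "ord n k > 0" using assms(1) by (simp add: ord_eq_0)
  then have "rev [0..<ord n k] \<in> realizing_seqs n k"
    using exponent_seq_full[OF assms] wt_full[OF assms]
    by (simp add: realizing_seqs_def reduced_def last_rev)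
  then obtain js where "js \<in> realizing_seqs n k"
    "\<And>is. is \<in> realizing_seqs n k \<Longrightarrow> length js \<le> length is"
    using ex_has_least_nat[of "\<lambda>js. js \<in> realizing_seqs n k" _ length] by blast
  then show ?thesis by (auto simp: minimal_prime_seqs_def)
qed

end

theory Submission
  imports Defs
begin

text \<open>
  Every element of the group has the form \<open>x\<^sup>h y\<^sup>c\<close>, and left multiplication acts on the pair
  \<open>(h, c)\<close> by simple rules: \<open>x\<close> raises the height \<open>h\<close> by \<open>1\<close>, while \<open>y x\<^sup>h = x\<^sup>h y\<^sup>t\<close> with
  \<open>t = k\<^sup>h\<close> shows that \<open>y\<close> fixes the height and adds \<open>k\<^sup>h\<close> to \<open>c\<close>. So a word, read from right to
  left, is a walk on the integers that starts at height \<open>0\<close>, together with a collection of multiples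
  of \<open>k\<^sup>h\<close> picked up at the heights \<open>h\<close> that the walk visits. Its length is the number of steps of
  the walk plus the sum of the absolute values of the multiples (lemma \<open>tour_length_le\<close>).

  Put \<open>s = \<alpha> / 2\<close>. Since \<open>k\<^sup>s = -1\<close>, the powers \<open>k\<^sup>h\<close> and \<open>k\<^sup>j\<close> agree up to sign whenever
  \<open>h \<equiv> j (mod s)\<close>, and a sign does not change the cost of a multiple. If \<open>\<Omega>(j, \<lambda>)\<close> is everything,
  a walk that ends at \<open>a\<close> and meets the residue class modulo \<open>s\<close> of each entry of the sequence \<open>j\<close>
  therefore reaches every element \<open>x\<^sup>a y\<^sup>c\<close> at cost at most the length of the walk plus the sum of
  \<open>\<lambda>\<close> (lemma \<open>length_le_of_Omega\<close>).

  It remains to find short walks. Because \<open>x\<^sup>m = 1\<close>, only \<open>\<bar>a\<bar> \<le> m / 2\<close> matters. Climbing from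
  \<open>0\<close> to a suitable top and then descending to \<open>a\<close> meets all classes of \<open>0, \<dots>, D\<close> modulo \<open>s\<close> in at
  most \<open>max(\<bar>a\<bar>, s + min(D, s))\<close> steps (lemma \<open>tour_covering_residues\<close>). If \<open>\<alpha> \<noteq> m\<close> then
  \<open>m \<ge> 2 \<alpha> = 4 s\<close>, so this is at most \<open>m / 2\<close> whatever \<open>D\<close> is, and the full sequence can be used.
  If \<open>\<alpha> = m\<close> then \<open>m / 2 = s\<close>, and a minimal prime sequence of degree \<open>D = deg(n, k; \<alpha>)\<close> gives
  walks of length at most \<open>m / 2 + D\<close>.
\<close>

section \<open>Word length and diameter\<close>

text \<open>
  Words are built by prepending letters, to match the left action on normal forms. The empty word is
  allowed for every bound, so that the bound need not be the exact length.
\<close>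

inductive word_length_le :: "('g, 'm) monoid_scheme \<Rightarrow> 'g set \<Rightarrow> nat \<Rightarrow> 'g \<Rightarrow> bool"
  for G :: "('g, 'm) monoid_scheme" and S :: "'g set"
where
  one: "word_length_le G S l \<one>\<^bsub>G\<^esub>"
| step: "s \<in> S \<Longrightarrow> word_length_le G S l g \<Longrightarrow> word_length_le G S (Suc l) (s \<otimes>\<^bsub>G\<^esub> g)"

lemma word_length_le_mono:
  assumes "word_length_le G S l g" "l \<le> l'"
  shows "word_length_le G S l' g"
  using assms
proof (induction arbitrary: l' rule: word_length_le.induct)
  case (one l)
  show ?case by (rule word_length_le.one)
next
  case (step s l g)
  then obtain l'' where "l' = Suc l''" "l \<le> l''" by (cases l') auto
  with step show ?case by (auto intro: word_length_le.step)
qed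

text \<open>
  Arcs multiply on the right, so reading a word for \<open>g\<close> from its first letter gives a walk from \<open>u\<close>
  to \<open>u g\<close>. The start \<open>u\<close> has to be arbitrary in the induction: the rest of the word is read from
  \<open>u s\<close>.
\<close>

lemma word_length_le_awalk:
  assumes "group G" "S \<subseteq> carrier G" "word_length_le G S l g" "u \<in> carrier G"
  shows "\<exists>p. pre_digraph.awalk (with_proj (cayley_graph G S)) u p (u \<otimes>\<^bsub>G\<^esub> g) \<and> length p \<le> l"
proof -
  interpret group G by fact
  interpret wf_digraph "with_proj (cayley_graph G S)"
    by (rule wf_digraph_cayley_graph) fact+
  have "g \<in> carrier G \<and> (\<forall>u\<in>carrier G. \<exists>p. awalk u p (u \<otimes>\<^bsub>G\<^esub> g) \<and> length p \<le> l)"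
    using assms(3)
  proof (induction rule: word_length_le.induct)
    case (one l)
    have "awalk u [] (u \<otimes>\<^bsub>G\<^esub> \<one>\<^bsub>G\<^esub>)" if "u \<in> carrier G" for u
      unfolding awalk_Nil_iff using that by (simp add: cayley_graph_def)
    then show ?case
      by (metis le0 list.size(3) one_closed)
  next
    case (step s l g)
    have s: "s \<in> carrier G" using step.hyps assms(2) by blast
    show ?case
    proof (intro conjI ballI)
      show "s \<otimes>\<^bsub>G\<^esub> g \<in> carrier G" using s step.IH by simp
      fix u assume u: "u \<in> carrier G"
      then obtain p where p: "awalk (u \<otimes>\<^bsub>G\<^esub> s) p (u \<otimes>\<^bsub>G\<^esub> s \<otimes>\<^bsub>G\<^esub> g)" "length p \<le> l"
        using step.IH s by blast
      have "awalk u ((u, u \<otimes>\<^bsub>G\<^esub> s) # p) (u \<otimes>\<^bsub>G\<^esub> (s \<otimes>\<^bsub>G\<^esub> g))"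
        unfolding awalk_Cons_iff
      proof (intro conjI)
        show "(u, u \<otimes>\<^bsub>G\<^esub> s) \<in> arcs (with_proj (cayley_graph G S))"
          using u step.hyps by (auto simp: cayley_graph_def)
      qed (use p(1) u s step.IH in \<open>simp_all add: m_assoc\<close>)
      with p(2) show "\<exists>p. awalk u p (u \<otimes>\<^bsub>G\<^esub> (s \<otimes>\<^bsub>G\<^esub> g)) \<and> length p \<le> Suc l"
        by (intro exI[of _ "(u, u \<otimes>\<^bsub>G\<^esub> s) # p"]) simp
    qed
  qed
  with assms(4) show ?thesis by blast
qed

lemma diameter_cayley_graph_le:
  assumes "group G" "S \<subseteq> carrier G" "\<And>g. g \<in> carrier G \<Longrightarrow> word_length_le G S l g"
  shows "diameter (with_proj (cayley_graph G S)) \<le> ereal (real l)"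
  unfolding diameter_def
proof (intro SUP_least)
  interpret group G by fact
  interpret wf_digraph "with_proj (cayley_graph G S)"
    by (rule wf_digraph_cayley_graph) fact+
  fix u v assume "u \<in> verts (with_proj (cayley_graph G S))" "v \<in> verts (with_proj (cayley_graph G S))"
  then have uv: "u \<in> carrier G" "v \<in> carrier G" by (simp_all add: cayley_graph_def)
  have "v = u \<otimes>\<^bsub>G\<^esub> (inv\<^bsub>G\<^esub> u \<otimes>\<^bsub>G\<^esub> v)" using uv by (simp add: m_assoc[symmetric])
  moreover have "word_length_le G S l (inv\<^bsub>G\<^esub> u \<otimes>\<^bsub>G\<^esub> v)" using uv assms(3) by simp
  ultimately obtain p where p: "awalk u p v" "length p \<le> l"
    using word_length_le_awalk[OF assms(1,2) _ uv(1)] by metis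
  have "awalk_cost (\<lambda>_. 1) p = real (length p)" by (induction p) simp_all
  then show "\<mu> (\<lambda>_. 1) u v \<le> ereal (real l)"
    using min_cost_le_walk_cost[OF p(1), of "\<lambda>_. 1"] p(2)
    by (metis ereal_less_eq(3) of_nat_le_iff order_trans)
qed

section \<open>Tours of integer intervals\<close>

text \<open>
  The relation \<open>tour V a l\<close> describes a nearest-neighbour walk on the integers from \<open>0\<close> to \<open>a\<close> with
  \<open>l\<close> steps; \<open>V\<close> is the set of integers that it visits.
\<close>

inductive tour :: "int set \<Rightarrow> int \<Rightarrow> nat \<Rightarrow> bool" where
  start: "tour {0} 0 0"
| up: "tour V a l \<Longrightarrow> tour (insert (a + 1) V) (a + 1) (Suc l)"
| down: "tour V a l \<Longrightarrow> tour (insert (a - 1) V) (a - 1) (Suc l)"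

lemma tour_up: "tour {0..int q} (int q) q"
proof (induction q)
  case 0
  show ?case using tour.start by simp
next
  case (Suc q)
  have "{0..int (Suc q)} = insert (int q + 1) {0..int q}" by auto
  with tour.up[OF Suc] show ?case by (simp add: add.commute)
qed

lemma tour_up_down: "tour ({0..int q} \<union> {int q - int d..int q}) (int q - int d) (q + d)"
proof (induction d)
  case 0
  show ?case using tour_up[of q] by (simp add: insert_absorb)
next
  case (Suc d)
  have "{0..int q} \<union> {int q - int (Suc d)..int q} =
      insert (int q - int d - 1) ({0..int q} \<union> {int q - int d..int q})" by auto
  with tour.down[OF Suc] show ?case by (simp add: algebra_simps)
qed

lemma tour_between:
  assumes "0 \<le> q" "a \<le> q"
  shows "\<exists>V. tour V a (nat (2 * q - a)) \<and> {min 0 a..q} \<subseteq> V"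
proof -
  have "tour ({0..q} \<union> {a..q}) a (nat q + nat (q - a))"
    using tour_up_down[of "nat q" "nat (q - a)"] assms by simp
  moreover have "nat q + nat (q - a) = nat (2 * q - a)" using assms by simp
  moreover have "{min 0 a..q} \<subseteq> {0..q} \<union> {a..q}" by auto
  ultimately show ?thesis by (intro exI[of _ "{0..q} \<union> {a..q}"]) simp
qed

lemma cong_representative_in_interval:
  fixes s p j :: int
  assumes "0 < s"
  shows "\<exists>h\<in>{p..p + s - 1}. [h = j] (mod s)"
proof -
  have "p + (j - p) mod s \<in> {p..p + s - 1}"
    using assms pos_mod_bound[of s "j - p"] by auto
  moreover have "[p + (j - p) mod s = j] (mod s)"
    by (simp add: cong_def mod_add_right_eq)
  ultimately show ?thesis by blast
qed

text \<open>
  The walk climbs to a top \<open>q\<close> and then descends to \<open>a\<close>, which takes \<open>2 q - a\<close> steps and visits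
  everything from \<open>min 0 a\<close> to \<open>q\<close>. There are two ways to meet the classes of \<open>0, \<dots>, D\<close>: climb to
  \<open>D\<close> itself, or visit \<open>s\<close> consecutive integers, which meet every class. The cheaper of the two
  gives the bound, unless no climb beyond \<open>max 0 a\<close> is needed, and then the walk goes straight to \<open>a\<close>.
\<close>

lemma tour_covering_residues:
  fixes s D :: nat and a :: int
  assumes "0 < s"
  shows "\<exists>V l. tour V a l \<and> l \<le> max (nat \<bar>a\<bar>) (s + min D s) \<and>
    (\<forall>j\<le>D. \<exists>h\<in>V. [h = int j] (mod int s))"
proof -
  \<comment> \<open>Climbing to \<open>T\<close> reaches \<open>D\<close> or completes \<open>s\<close> consecutive integers, whichever happens first.\<close>
  define T where "T = min (int D) (int s - 1 + min 0 a)"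
  define q where "q = max (max 0 a) T"
  obtain V where V: "tour V a (nat (2 * q - a))" "{min 0 a..q} \<subseteq> V"
    using tour_between[of q a] unfolding q_def by (metis max.cobounded1 max.cobounded2 order_trans)
  have len: "nat (2 * q - a) \<le> max (nat \<bar>a\<bar>) (s + min D s)"
  proof (cases "T \<le> max 0 a")
    case True
    then have "2 * q - a = \<bar>a\<bar>" by (simp add: q_def)
    then show ?thesis by (simp add: max.coboundedI1)
  next
    case False
    then have "q = T" by (simp add: q_def)
    moreover have "T \<le> int (min D s)" "T - a \<le> int s"
      by (auto simp: T_def)
    ultimately have "nat (2 * q - a) \<le> s + min D s" by linarith
    then show ?thesis by (simp add: max.coboundedI2)
  qed
  have cover: "\<exists>h\<in>V. [h = int j] (mod int s)" if j: "j \<le> D" for j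
  proof (cases "int D \<le> q")
    case True
    then have "int j \<in> V" using V(2) j by auto
    then show ?thesis by (auto intro: cong_refl)
  next
    case False
    then have "min 0 a + int s - 1 \<le> q" by (auto simp: q_def T_def)
    then have "{min 0 a..min 0 a + int s - 1} \<subseteq> V" using V(2) by auto
    then show ?thesis
      using cong_representative_in_interval[of "int s" "min 0 a" "int j"] assms
      by (meson of_nat_0_less_iff subsetD)
  qed
  from V(1) len cover show ?thesis by blast
qed

section \<open>Elements as walks\<close>

lemma (in group) int_pow_cong:
  assumes "z \<in> carrier G" "z [^] (N :: nat) = \<one>" "[a = b] (mod int N)"
  shows "z [^] a = z [^] b"
proof -
  obtain q where "a = b + int N * q"
    using assms(3) by (metis cong_iff_lin cong_sym)
  moreover have "z [^] (int N * q) = \<one>"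
    using assms(1,2) by (simp add: int_pow_pow[symmetric] int_pow_int)
  ultimately show ?thesis using assms(1) by (simp add: int_pow_mult)
qed

text \<open>
  The argument needs only the relations and the normal form, so it is carried out for any two
  elements of any group that satisfy the relations.
\<close>

locale metacyclic_relations = group G for G (structure) +
  fixes x y and m n k :: nat
  assumes m_pos: "0 < m"
    and x_closed [simp]: "x \<in> carrier G" and y_closed [simp]: "y \<in> carrier G"
    and x_pow: "x [^] m = \<one>" and y_pow: "y [^] n = \<one>"
    and conj: "inv x \<otimes> y \<otimes> x = y [^] k"
begin

abbreviation length_le where
  "length_le \<equiv> word_length_le G {x, inv x, y, inv y}"

definition normal_form :: "int \<Rightarrow> int \<Rightarrow> 'a" where
  "normal_form h c = x [^] h \<otimes> y [^] c"

text \<open>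
  This is \<open>k\<^sup>h\<close> modulo \<open>n\<close> for an integer \<open>h\<close>; the exponent is reduced modulo \<open>m\<close>, so that a power of
  a natural number expresses it for negative heights too.
\<close>

definition twist :: "int \<Rightarrow> int" where
  "twist h = int k ^ nat (h mod int m)"

lemma normal_form_closed [simp]: "normal_form h c \<in> carrier G"
  by (simp add: normal_form_def)

lemma normal_form_cong:
  assumes "[h = h'] (mod int m)" "[c = c'] (mod int n)"
  shows "normal_form h c = normal_form h' c'"
  using int_pow_cong[OF x_closed x_pow assms(1)] int_pow_cong[OF y_closed y_pow assms(2)]
  by (simp add: normal_form_def)

lemma y_pow_x: "y [^] (b :: nat) \<otimes> x = x \<otimes> y [^] (k * b)"
proof (induction b)
  case 0
  show ?case by simp
next
  case (Suc b)
  have yx: "y \<otimes> x = x \<otimes> y [^] k"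
    by (simp add: conj[symmetric] m_assoc[symmetric])
  have "y [^] Suc b \<otimes> x = y [^] b \<otimes> x \<otimes> y [^] k"
    by (simp add: m_assoc yx)
  also have "\<dots> = x \<otimes> y [^] (k * Suc b)"
    by (simp add: Suc m_assoc nat_pow_mult add.commute)
  finally show ?case .
qed

lemma y_x_pow: "y \<otimes> x [^] (t :: nat) = x [^] t \<otimes> y [^] (k ^ t)"
proof (induction t)
  case 0
  show ?case by simp
next
  case (Suc t)
  have "y \<otimes> x [^] Suc t = x [^] t \<otimes> (y [^] (k ^ t) \<otimes> x)"
    by (simp add: m_assoc[symmetric] Suc)
  then show ?case by (simp add: y_pow_x m_assoc)
qed

lemma y_x_int_pow: "y \<otimes> x [^] h = x [^] h \<otimes> y [^] twist h"
proof -
  have "x [^] h = x [^] int (nat (h mod int m))"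
    using m_pos by (intro int_pow_cong[OF x_closed x_pow]) (simp add: cong_def)
  then have h: "x [^] h = x [^] nat (h mod int m)"
    by (simp only: int_pow_int)
  have "y [^] twist h = y [^] (k ^ nat (h mod int m))"
    unfolding twist_def of_nat_power[symmetric] int_pow_int ..
  then show ?thesis by (simp only: h y_x_pow)
qed

lemma x_normal_form: "x \<otimes> normal_form h c = normal_form (h + 1) c"
proof -
  have "x [^] (h + 1) = x \<otimes> x [^] h"
    using int_pow_mult[OF x_closed, of 1 h] by (simp add: add.commute)
  then show ?thesis by (simp add: normal_form_def m_assoc)
qed

lemma inv_x_normal_form: "inv x \<otimes> normal_form h c = normal_form (h - 1) c"
  using x_normal_form[of "h - 1" c] by (simp add: inv_solve_left')

lemma y_normal_form: "y \<otimes> normal_form h c = normal_form h (c + twist h)"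
proof -
  have "y \<otimes> normal_form h c = (y \<otimes> x [^] h) \<otimes> y [^] c"
    by (simp add: normal_form_def m_assoc)
  then show ?thesis
    by (simp add: normal_form_def y_x_int_pow m_assoc int_pow_mult[symmetric] add.commute)
qed

lemma inv_y_normal_form: "inv y \<otimes> normal_form h c = normal_form h (c - twist h)"
  using y_normal_form[of h "c - twist h"] by (simp add: inv_solve_left')

text \<open>Prepending \<open>\<bar>b\<bar>\<close> letters \<open>y\<close> or \<open>y\<^sup>-\<^sup>1\<close> adds a multiple of the power at the current height.\<close>

lemma length_le_add_height_multiple:
  assumes "length_le l (normal_form h c)"
  shows "length_le (l + nat \<bar>b\<bar>) (normal_form h (c + b * twist h))"
proof -
  have "length_le (l + i) (normal_form h (c + int i * twist h)) \<and>
      length_le (l + i) (normal_form h (c - int i * twist h))" for i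
  proof (induction i)
    case 0
    show ?case using assms by simp
  next
    case (Suc i)
    then have "length_le (Suc (l + i)) (y \<otimes> normal_form h (c + int i * twist h))"
      "length_le (Suc (l + i)) (inv y \<otimes> normal_form h (c - int i * twist h))"
      by (auto intro: word_length_le.step)
    then show ?case
      by (simp add: y_normal_form inv_y_normal_form algebra_simps)
  qed
  from this[of "nat \<bar>b\<bar>"] show ?thesis by (cases "b \<ge> 0") auto
qed

text \<open>
  The multiples are indexed by \<open>J\<close>, and \<open>ht j\<close> is the height at which the multiple with index \<open>j\<close> is
  picked up. The induction follows the walk for all \<open>J\<close> at once: the indices whose height is the
  present end of the walk are served last, and the others are served by the walk without its last
  step.
\<close>

lemma tour_length_le:
  assumes "tour V a l" "finite J" "\<And>j. j \<in> J \<Longrightarrow> ht j \<in> V"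
  shows "length_le (l + (\<Sum>j\<in>J. nat \<bar>b j\<bar>)) (normal_form a (\<Sum>j\<in>J. b j * twist (ht j)))"
  using assms
proof (induction arbitrary: J rule: tour.induct)
  have here: "length_le (l + (\<Sum>j\<in>J. nat \<bar>b j\<bar>)) (normal_form a (c + (\<Sum>j\<in>J. b j * twist (ht j))))"
    if "finite J" "\<And>j. j \<in> J \<Longrightarrow> ht j = a" "length_le l (normal_form a c)" for a c l J
    using that
  proof (induction J arbitrary: l c rule: finite_induct)
    case empty
    then show ?case by simp
  next
    case (insert j J)
    have "length_le (l + nat \<bar>b j\<bar>) (normal_form a (c + b j * twist (ht j)))"
      using insert.prems length_le_add_height_multiple by auto
    from insert.IH[OF _ this] insert.prems insert.hyps show ?case
      by (simp add: algebra_simps)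
  qed
  have extend: "length_le (Suc l + (\<Sum>j\<in>J. nat \<bar>b j\<bar>)) (normal_form a' (\<Sum>j\<in>J. b j * twist (ht j)))"
    if J: "finite J" "\<And>j. j \<in> J \<Longrightarrow> ht j \<in> insert a' V"
      and IH: "\<And>J. \<lbrakk>finite J; \<And>j. j \<in> J \<Longrightarrow> ht j \<in> V\<rbrakk> \<Longrightarrow>
        length_le (l + (\<Sum>j\<in>J. nat \<bar>b j\<bar>)) (normal_form a (\<Sum>j\<in>J. b j * twist (ht j)))"
      and z: "z \<in> {x, inv x, y, inv y}" "\<And>c. z \<otimes> normal_form a c = normal_form a' c"
    for V a a' l J z
  proof -
    let ?B = "{j. ht j = a'}"
    have "length_le (l + (\<Sum>j\<in>J - ?B. nat \<bar>b j\<bar>)) (normal_form a (\<Sum>j\<in>J - ?B. b j * twist (ht j)))"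
      using J by (intro IH) auto
    from word_length_le.step[OF z(1) this]
    have "length_le (Suc (l + (\<Sum>j\<in>J - ?B. nat \<bar>b j\<bar>)))
        (normal_form a' (\<Sum>j\<in>J - ?B. b j * twist (ht j)))"
      by (simp only: z(2))
    then have "length_le (Suc (l + (\<Sum>j\<in>J - ?B. nat \<bar>b j\<bar>)) + (\<Sum>j\<in>J \<inter> ?B. nat \<bar>b j\<bar>))
        (normal_form a' ((\<Sum>j\<in>J - ?B. b j * twist (ht j)) + (\<Sum>j\<in>J \<inter> ?B. b j * twist (ht j))))"
      using J(1) by (intro here) auto
    then show ?thesis
      by (simp only: sum.Int_Diff[OF J(1), of _ ?B] add_Suc add_Suc_right add_ac)
  qed
  {
    case start
    have "length_le 0 (normal_form 0 0)"
      by (simp add: normal_form_def word_length_le.one)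
    with here[of J 0 0 0] start show ?case by simp
  next
    case (up V a l)
    show ?case
      by (rule extend[OF up.prems up.IH, of x]) (simp_all add: x_normal_form)
  next
    case (down V a l)
    show ?case
      by (rule extend[OF down.prems down.IH, of "inv x"]) (simp_all add: inv_x_normal_form)
  }
qed

end

section \<open>Powers modulo a sign\<close>

text \<open>
  Adding \<open>s\<close> to an exponent multiplies the power by \<open>-1\<close>. Both exponents are raised by multiples of
  \<open>s\<close> until they coincide, which avoids deciding which of them is larger.
\<close>

lemma power_cong_up_to_sign:
  fixes c :: int and s :: nat
  assumes "[c ^ s = -1] (mod N)" "[int i = int j] (mod int s)"
  shows "\<exists>e\<in>{1, -1}. [c ^ i = e * c ^ j] (mod N)"
proof -
  have shift: "\<exists>e\<in>{1, -1}. [c ^ (t + s * z) = e * c ^ t] (mod N)" for t z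
  proof (rule bexI)
    have "[c ^ t * (c ^ s) ^ z = c ^ t * (-1) ^ z] (mod N)"
      by (intro cong_mult cong_pow cong_refl assms(1))
    then show "[c ^ (t + s * z) = (-1) ^ z * c ^ t] (mod N)"
      by (simp add: power_add power_mult mult.commute)
    show "(-1 :: int) ^ z \<in> {1, -1}" by (cases "even z") auto
  qed
  have "[i = j] (mod s)" using assms(2) by (simp add: cong_int_iff)
  then obtain u v where "i + s * u = j + s * v"
    by (metis cong_iff_lin_nat mult.commute)
  moreover obtain d where d: "d \<in> {1, -1}" "[c ^ (i + s * u) = d * c ^ i] (mod N)"
    using shift by blast
  moreover obtain e where e: "e \<in> {1, -1}" "[c ^ (j + s * v) = e * c ^ j] (mod N)"
    using shift by blast
  ultimately have "[d * c ^ i = e * c ^ j] (mod N)"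
    by (metis cong_sym cong_trans)
  then have "[d * (d * c ^ i) = d * (e * c ^ j)] (mod N)"
    by (rule cong_scalar_left)
  with d(1) e(1) have "[c ^ i = (d * e) * c ^ j] (mod N)" "d * e \<in> {1, -1}"
    by (auto simp: mult.assoc)
  then show ?thesis by blast
qed

text \<open>
  A representation of \<open>c\<close> by the exponents \<open>js\<close> turns into multiples picked up along a walk: each
  exponent is replaced by a visited height in its class modulo \<open>s\<close>, and the resulting sign is moved
  into the coefficient, whose absolute value stays the same.
\<close>

lemma (in metacyclic_relations) length_le_of_Omega:
  assumes s: "0 < s" "s dvd m" "[int k ^ s = -1] (mod int n)"
    and D: "\<And>j. j \<in> set js \<Longrightarrow> j \<le> D"
    and len: "length ls = length js"
    and c: "c mod int n \<in> Omega n k js ls"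
  shows "length_le (max (nat \<bar>a\<bar>) (s + min D s) + sum_list ls) (normal_form a c)"
proof -
  obtain b where b: "c mod int n = (\<Sum>j<length js. b j * int k ^ (js ! j)) mod int n"
    "\<And>j. j < length js \<Longrightarrow> \<bar>b j\<bar> \<le> int (ls ! j)"
    using c by (auto simp: Omega_def)
  obtain V l where V: "tour V a l" "l \<le> max (nat \<bar>a\<bar>) (s + min D s)"
    "\<And>j. j \<le> D \<Longrightarrow> \<exists>h\<in>V. [h = int j] (mod int s)"
    using tour_covering_residues[OF s(1)] by blast
  have "\<exists>h e. h \<in> V \<and> e \<in> {1, -1} \<and> [int k ^ (js ! j) = e * twist h] (mod int n)"
    if j: "j < length js" for j
  proof -
    obtain h where h: "h \<in> V" "[h = int (js ! j)] (mod int s)"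
      using V(3)[OF D[OF nth_mem[OF j]]] by blast
    \<comment> \<open>The reduction modulo \<open>m\<close> in the twist keeps the class modulo \<open>s\<close>, because \<open>s\<close> divides \<open>m\<close>.\<close>
    have "[h mod int m = h] (mod int s)"
      using s(2) by (simp add: cong_def mod_mod_cancel)
    with h(2) have "[int (js ! j) = int (nat (h mod int m))] (mod int s)"
      using m_pos by (auto intro: cong_sym cong_trans)
    from power_cong_up_to_sign[OF s(3) this] h(1) show ?thesis
      unfolding twist_def by blast
  qed
  then obtain h e where he: "\<And>j. j < length js \<Longrightarrow> h j \<in> V"
    "\<And>j. j < length js \<Longrightarrow> e j \<in> {1, -1}"
    "\<And>j. j < length js \<Longrightarrow> [int k ^ (js ! j) = e j * twist (h j)] (mod int n)"
    by metis
  have "length_le (l + (\<Sum>j<length js. nat \<bar>b j * e j\<bar>))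
      (normal_form a (\<Sum>j<length js. (b j * e j) * twist (h j)))"
    using V(1) he(1) by (intro tour_length_le) auto
  moreover have "normal_form a (\<Sum>j<length js. (b j * e j) * twist (h j)) = normal_form a c"
  proof (intro normal_form_cong cong_refl)
    have "[(\<Sum>j<length js. (b j * e j) * twist (h j)) =
        (\<Sum>j<length js. b j * int k ^ (js ! j))] (mod int n)"
      using he(3) by (intro cong_sum) (simp add: mult.assoc cong_scalar_left cong_sym)
    then show "[(\<Sum>j<length js. (b j * e j) * twist (h j)) = c] (mod int n)"
      using b(1) by (simp add: cong_def)
  qed
  moreover have "(\<Sum>j<length js. nat \<bar>b j * e j\<bar>) \<le> (\<Sum>j<length js. ls ! j)"
  proof (intro sum_mono)
    fix j assume "j \<in> {..<length js}"
    then have "j < length js" by simp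
    from b(2)[OF this] he(2)[OF this] show "nat \<bar>b j * e j\<bar> \<le> ls ! j"
      by (auto simp: nat_le_iff)
  qed
  then have "(\<Sum>j<length js. nat \<bar>b j * e j\<bar>) \<le> sum_list ls"
    by (simp add: sum_list_sum_nth len atLeast0LessThan)
  then have "l + (\<Sum>j<length js. nat \<bar>b j * e j\<bar>) \<le>
      max (nat \<bar>a\<bar>) (s + min D s) + sum_list ls"
    using V(2) by (rule add_mono[rotated])
  ultimately show ?thesis
    by (simp only: word_length_le_mono)
qed

section \<open>The presented group\<close>

lemma word_class_Cons:
  "word_class R (l # w) = word_class R [l] \<otimes>\<^bsub>presented_group R\<^esub> word_class R w"
  by (simp add: presented_group_mult)

lemma word_class_closed [simp]: "word_class R w \<in> carrier (presented_group R)"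
  by (simp add: presented_group_def)

lemma word_class_inverse_letter:
  "word_class R [(a, True)] = inv\<^bsub>presented_group R\<^esub> word_class R [(a, False)]"
proof -
  interpret group "presented_group R" by (rule group_presented_group)
  have "word_class R [(a, True)] \<otimes>\<^bsub>presented_group R\<^esub> word_class R [(a, False)] =
      \<one>\<^bsub>presented_group R\<^esub>"
    using pres_eq.cancel[of R a True]
    unfolding presented_group_mult by (simp add: presented_group_def word_class_eq_iff)
  then show ?thesis by (simp add: inv_equality)
qed

lemma word_class_replicate:
  "word_class R (replicate i (a, False)) =
    word_class R [(a, False)] [^]\<^bsub>presented_group R\<^esub> i"
proof -
  interpret group "presented_group R" by (rule group_presented_group)
  have "\<one>\<^bsub>presented_group R\<^esub> = word_class R []" by (simp add: presented_group_def)
  then show ?thesis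
  proof (induction i)
    case (Suc i)
    have "replicate (Suc i) (a, False) = replicate i (a, False) @ [(a, False)]"
      by (simp add: replicate_append_same)
    then show ?case using Suc by (simp only: presented_group_mult[symmetric] nat_pow_Suc)
  qed simp
qed

lemma metacyclic_group_relations:
  assumes "0 < m"
  shows "metacyclic_relations (metacyclic_group m n k)
    (metacyclic_gen m n k X) (metacyclic_gen m n k Y) m n k"
proof -
  let ?R = "metacyclic_rels m n k"
  interpret group "presented_group ?R" by (rule group_presented_group)
  have one: "\<one>\<^bsub>presented_group ?R\<^esub> = word_class ?R []" by (simp add: presented_group_def)
  have rel: "word_class ?R u = word_class ?R v" if "(u, v) \<in> ?R" for u v
    using that by (simp add: word_class_eq_iff pres_eq.rel)
  show ?thesis
    unfolding metacyclic_group_def metacyclic_gen_def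
  proof unfold_locales
    show "word_class ?R [(X, False)] [^]\<^bsub>presented_group ?R\<^esub> m = \<one>\<^bsub>presented_group ?R\<^esub>"
      unfolding one word_class_replicate[symmetric]
      by (rule rel) (simp add: metacyclic_rels_def)
    show "word_class ?R [(Y, False)] [^]\<^bsub>presented_group ?R\<^esub> n = \<one>\<^bsub>presented_group ?R\<^esub>"
      unfolding one word_class_replicate[symmetric]
      by (rule rel) (simp add: metacyclic_rels_def)
    have "word_class ?R [(X, True), (Y, False), (X, False)] = word_class ?R (replicate k (Y, False))"
      by (rule rel) (simp add: metacyclic_rels_def)
    then show "inv\<^bsub>presented_group ?R\<^esub> word_class ?R [(X, False)]
        \<otimes>\<^bsub>presented_group ?R\<^esub> word_class ?R [(Y, False)]
        \<otimes>\<^bsub>presented_group ?R\<^esub> word_class ?R [(X, False)] =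
        word_class ?R [(Y, False)] [^]\<^bsub>presented_group ?R\<^esub> k"
      by (simp add: word_class_inverse_letter[symmetric] word_class_replicate[symmetric]
          presented_group_mult)
  qed (use assms in simp_all)
qed

text \<open>
  The elements in normal form contain the identity and are stable under left multiplication by the
  generators and their inverses, hence exhaust the group.
\<close>

lemma metacyclic_group_normal_form:
  assumes "0 < m" "g \<in> carrier (metacyclic_group m n k)"
  shows "\<exists>h c. g = metacyclic_relations.normal_form (metacyclic_group m n k)
    (metacyclic_gen m n k X) (metacyclic_gen m n k Y) h c"
proof -
  interpret metacyclic_relations "metacyclic_group m n k"
    "metacyclic_gen m n k X" "metacyclic_gen m n k Y" m n k
    by (rule metacyclic_group_relations[OF assms(1)])
  let ?R = "metacyclic_rels m n k"
  have "\<exists>h c. word_class ?R w = normal_form h c" for w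
  proof (induction w)
    case Nil
    have "word_class ?R [] = \<one>\<^bsub>metacyclic_group m n k\<^esub>"
      by (simp add: metacyclic_group_def presented_group_def)
    then have "word_class ?R [] = normal_form 0 0"
      by (simp add: normal_form_def)
    then show ?case by blast
  next
    case (Cons z w)
    then obtain h c where w: "word_class ?R w = normal_form h c" by blast
    obtain a e where z: "z = (a, e)" by (cases z)
    have "word_class ?R [z] = (if e then inv\<^bsub>metacyclic_group m n k\<^esub> metacyclic_gen m n k a
        else metacyclic_gen m n k a)"
      by (simp add: z metacyclic_gen_def metacyclic_group_def word_class_inverse_letter)
    moreover have "word_class ?R (z # w) =
        word_class ?R [z] \<otimes>\<^bsub>metacyclic_group m n k\<^esub> normal_form h c"
      using word_class_Cons[of ?R z w] unfolding w by (simp add: metacyclic_group_def)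
    ultimately show ?case
      by (cases a; cases e)
        (auto simp: x_normal_form inv_x_normal_form y_normal_form inv_y_normal_form)
  qed
  moreover obtain w where "g = word_class ?R w"
    using assms(2) by (auto simp: metacyclic_group_def presented_group_def)
  ultimately show ?thesis by blast
qed

lemma balanced_representative:
  fixes h :: int and m :: nat
  assumes "0 < m"
  shows "\<exists>a. [h = a] (mod int m) \<and> nat \<bar>a\<bar> \<le> m div 2"
proof (cases "h mod int m \<le> int (m div 2)")
  case True
  then show ?thesis
    using assms by (intro exI[of _ "h mod int m"]) (auto simp: cong_def nat_le_iff)
next
  case False
  have "h mod int m < int m" using assms by simp
  with False have "nat \<bar>h mod int m - int m\<bar> \<le> m div 2" by linarith
  then show ?thesis by (intro exI[of _ "h mod int m - int m"]) (simp add: cong_def)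
qed

text \<open>
  The common form of both cases of the theorem: each exponent sequence bounds the diameter, with \<open>D\<close>
  a bound for its degree.
\<close>

lemma metacyclic_diam_le:
  assumes "0 < m" "0 < n" "coprime n k"
    and s: "0 < s" "s dvd m" "[int k ^ s = -1] (mod int n)"
    and js: "exponent_seq n k js"
    and D: "\<And>j. j \<in> set js \<Longrightarrow> j \<le> D"
  shows "metacyclic_diam m n k \<le> ereal (real (max (m div 2) (s + min D s) + wt_seq n k js))"
proof -
  let ?G = "metacyclic_group m n k"
  interpret metacyclic_relations ?G
    "metacyclic_gen m n k X" "metacyclic_gen m n k Y" m n k
    by (rule metacyclic_group_relations[OF assms(1)])
  let ?W = "{sum_list ls | ls.
       length ls = length js \<and> Omega n k js ls = carrier (residue_ring (int n))}"
  have "?W \<noteq> {}" using wt_seq_attained[OF assms(2,3) js] by blast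
  then have "wt_seq n k js \<in> ?W" unfolding wt_seq_def by (rule Inf_nat_def1)
  then obtain ls where ls: "length ls = length js" "sum_list ls = wt_seq n k js"
    "Omega n k js ls = carrier (residue_ring (int n))" by auto
  show ?thesis
    unfolding metacyclic_diam_def Let_def
  proof (rule diameter_cayley_graph_le)
    fix g assume "g \<in> carrier ?G"
    then obtain h c where g: "g = normal_form h c"
      using metacyclic_group_normal_form[OF assms(1)] by blast
    obtain a where a: "[h = a] (mod int m)" "nat \<bar>a\<bar> \<le> m div 2"
      using balanced_representative[OF assms(1)] by blast
    have "g = normal_form a c"
      unfolding g by (intro normal_form_cong a(1) cong_refl)
    moreover have "c mod int n \<in> Omega n k js ls"
      using assms(2) by (simp add: ls(3) residue_ring_def)
    then have "length_le (max (nat \<bar>a\<bar>) (s + min D s) + sum_list ls) (normal_form a c)"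
      by (intro length_le_of_Omega[OF s D ls(1)])
    moreover have "max (nat \<bar>a\<bar>) (s + min D s) + sum_list ls
        \<le> max (m div 2) (s + min D s) + wt_seq n k js"
      unfolding ls(2) using a(2) by (intro add_mono max.mono order_refl)
    ultimately show "length_le (max (m div 2) (s + min D s) + wt_seq n k js) g"
      by (simp only: word_length_le_mono)
  qed (auto intro: is_group)
qed

theorem theorem1:
  fixes m n k \<alpha> :: nat
  assumes "m > 0" and "n \<ge> 3"
    and "coprime n k" and "\<alpha> = ord n k" and "\<alpha> dvd m"
    and "even \<alpha>" and "[int k ^ (\<alpha> div 2) = -1] (mod int n)"
  shows "metacyclic_diam m n k \<le>
    ereal (real (if \<alpha> \<noteq> m then m div 2 + wt n k \<alpha>
                 else m div 2 + wt n k \<alpha> + deg_wt n k))"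
proof -
  have "0 < \<alpha>" using assms(1,5) by (auto intro: Nat.gr0I)
  define s where "s = \<alpha> div 2"
  have \<alpha>: "\<alpha> = 2 * s" using assms(6) by (simp add: s_def)
  have s: "0 < s" "s dvd m" "[int k ^ s = -1] (mod int n)"
    using \<open>0 < \<alpha>\<close> assms(5,7) \<alpha> by (auto simp: s_def[symmetric] dvd_mult_right)
  have n: "0 < n" using assms(2) by simp
  note diam = metacyclic_diam_le[OF assms(1) n assms(3) s]
  show ?thesis
  proof (cases "\<alpha> = m")
    case False
    \<comment> \<open>A proper multiple of \<open>\<alpha>\<close> is at least \<open>4 s\<close>, so half of it leaves room for \<open>2 s\<close> steps.\<close>
    obtain t where t: "m = \<alpha> * t" using assms(5) by blast
    with False assms(1) have "2 \<le> t" by (cases t; cases "t - 1") auto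
    then have "s + min (\<alpha> - 1) s \<le> m div 2"
      using mult_le_mono2[of 2 t s] unfolding t \<alpha> by (simp add: mult.assoc mult_2_right)
    moreover have "metacyclic_diam m n k \<le>
        ereal (real (max (m div 2) (s + min (\<alpha> - 1) s) + wt n k \<alpha>))"
      using diam[of "rev [0..<\<alpha>]" "\<alpha> - 1"] exponent_seq_full[OF assms(3) n]
        wt_full[OF assms(3) n] assms(4) by auto
    ultimately show ?thesis using False by (simp add: max_absorb1)
  next
    case True
    have "deg_wt n k \<in> deg_seq ` minimal_prime_seqs n k"
      unfolding deg_wt_def using minimal_prime_seqs_nonempty[OF assms(3) n]
      by (intro Inf_nat_def1) simp
    then obtain js where js: "js \<in> minimal_prime_seqs n k" "deg_wt n k = hd js"
      by (auto simp: deg_seq_def)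
    then have seq: "exponent_seq n k js" "wt_seq n k js = wt n k \<alpha>"
      using assms(4) by (auto simp: minimal_prime_seqs_def realizing_seqs_def)
    have "j \<le> hd js" if "j \<in> set js" for j
      using seq(1) that by (cases js) (auto simp: exponent_seq_def)
    from diam[OF seq(1) this]
    have "metacyclic_diam m n k \<le>
        ereal (real (max (m div 2) (s + min (deg_wt n k) s) + wt n k \<alpha>))"
      by (simp add: seq(2) js(2))
    also have "\<dots> \<le> ereal (real (m div 2 + wt n k \<alpha> + deg_wt n k))"
      using True \<alpha> by auto
    finally show ?thesis using True by simp
  qed
qed

end
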